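(* Let $\mathcal H$ be a complex, separable, infinite-dimensional Hilbert space and let $T \in \mathcal B(\mathcal H)$. Then $T$ is a product of two nilpotent operators in $\mathcal B(\mathcal H)$ if and only if $\dim \ker T = \dim \ker T^* = \infty$. Moreover, in this case the two nilpotent factors can be chosen with index of nilpotency at most $3$.
   Context: $\mathcal B(\mathcal H)$ denotes the algebra of all bounded linear operators on $\mathcal H$. An operator $N \in \mathcal B(\mathcal H)$ is nilpotent if $N^k = 0$ for some positive integer $k$; the least such $k$ is its index of nilpotency. *)

theory Defs
  imports "HOL-Analysis.Analysis"
begin

(* The inner product is linear in its first argument.  Metric, topology and
   completeness come from the real Banach space structure, which the last axioms of
   the two classes tie to the complex scalars and to the inner product. *)

class complex_normed_vector = real_normed_vector +
  fixes scaleC :: "complex \<Rightarrow> 'a \<Rightarrow> 'a"  (infixr "*\<^sub>C" 75)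
  assumes scaleC_add_right: "a *\<^sub>C (x + y) = a *\<^sub>C x + a *\<^sub>C y"
    and scaleC_add_left: "(a + b) *\<^sub>C x = a *\<^sub>C x + b *\<^sub>C x"
    and scaleC_scaleC: "a *\<^sub>C (b *\<^sub>C x) = (a * b) *\<^sub>C x"
    and scaleC_one: "1 *\<^sub>C x = x"
    and norm_scaleC: "norm (a *\<^sub>C x) = cmod a * norm x"
    and scaleR_scaleC: "r *\<^sub>R x = complex_of_real r *\<^sub>C x"

class complex_hilbert_space = complex_normed_vector + complete_space +
  fixes cinner :: "'a \<Rightarrow> 'a \<Rightarrow> complex"
  assumes cinner_commute: "cinner x y = cnj (cinner y x)"
    and cinner_add_left: "cinner (x + y) z = cinner x z + cinner y z"
    and cinner_scaleC_left: "cinner (a *\<^sub>C x) y = a * cinner x y"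
    and norm_cinner: "cinner x x = complex_of_real ((norm x)\<^sup>2)"

global_interpretation complex_vector: vector_space "scaleC :: complex \<Rightarrow> 'a \<Rightarrow> 'a::complex_normed_vector"
  defines cspan = complex_vector.span
    and csubspace = complex_vector.subspace
  by unfold_locales (simp_all add: scaleC_add_right scaleC_add_left scaleC_scaleC scaleC_one)

instantiation complex :: complex_hilbert_space
begin

definition scaleC_complex :: "complex \<Rightarrow> complex \<Rightarrow> complex"
  where "scaleC_complex a x = a * x"

definition cinner_complex :: "complex \<Rightarrow> complex \<Rightarrow> complex"
  where "cinner_complex x y = x * cnj y"

instance
proof
  fix a x y z :: complex and r :: real
  show "cinner x x = complex_of_real ((norm x)\<^sup>2)"
    by (simp only: cinner_complex_def complex_norm_square)
  show "r *\<^sub>R x = complex_of_real r *\<^sub>C x"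
    by (simp add: scaleC_complex_def scaleR_conv_of_real)
qed (simp_all add: scaleC_complex_def cinner_complex_def norm_mult distrib_left distrib_right mult.assoc mult.commute)

end

(* Used for linear subspaces only.  A Hilbert space is infinite-dimensional in the
   sense of orthonormal bases iff no finite set spans it algebraically; the library's
   natural-number valued dim cannot express this, being 0 on such spaces. *)
definition infinite_cdim :: "'a::complex_normed_vector set \<Rightarrow> bool"
  where "infinite_cdim S \<longleftrightarrow> (\<nexists>B. finite B \<and> cspan B = S)"

definition bounded_clinear :: "('a::complex_normed_vector \<Rightarrow> 'b::complex_normed_vector) \<Rightarrow> bool"
  where "bounded_clinear T \<longleftrightarrow>
    Vector_Spaces.linear scaleC scaleC T \<and> (\<exists>K. \<forall>x. norm (T x) \<le> K * norm x)"

(* The defining property determines the adjoint uniquely; it exists for bounded T. *)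
definition cadjoint :: "('a::complex_hilbert_space \<Rightarrow> 'b::complex_hilbert_space) \<Rightarrow> 'b \<Rightarrow> 'a"
  where "cadjoint T = (THE S. \<forall>x y. cinner (T x) y = cinner x (S y))"

lemma cadjoint_unique:
  fixes T :: "'a::complex_hilbert_space \<Rightarrow> 'b::complex_hilbert_space"
  assumes "\<And>x y. cinner (T x) y = cinner x (S y)"
  shows "cadjoint T = S"
  unfolding cadjoint_def
proof (rule the_equality)
  show "\<forall>x y. cinner (T x) y = cinner x (S y)"
    using assms by blast
next
  fix S' assume S': "\<forall>x y. cinner (T x) y = cinner x (S' y)"
  show "S' = S"
  proof
    fix y
    define d where "d = S' y - S y"
    have "cinner (S' y) d = cinner (S y) d"
      using S' assms[of d y] cinner_commute[of "S' y" d] cinner_commute[of "S y" d] by simp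
    moreover have "cinner (S' y) d = cinner d d + cinner (S y) d"
      unfolding cinner_add_left[symmetric] by (simp add: d_def)
    ultimately have "norm d = 0"
      by (simp add: norm_cinner)
    then show "S' y = S y"
      by (simp add: d_def)
  qed
qed

definition nilpotent_operator :: "('a::complex_normed_vector \<Rightarrow> 'a) \<Rightarrow> bool"
  where "nilpotent_operator N \<longleftrightarrow> bounded_clinear N \<and> (\<exists>k>0. N ^^ k = (\<lambda>x. 0))"

definition nilpotency_index :: "('a::complex_normed_vector \<Rightarrow> 'a) \<Rightarrow> nat"
  where "nilpotency_index N = (LEAST k. k > 0 \<and> N ^^ k = (\<lambda>x. 0))"

end

theory Submission
  imports Defs
begin

text \<open>
  The kernel of a nilpotent operator on an infinite-dimensional space is infinite-dimensional,
  and \<open>ker B \<subseteq> ker (A B)\<close>, \<open>ker A\<^sup>* \<subseteq> ker (A B)\<^sup>*\<close>.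
  Conversely, choose inductively orthonormal sequences \<open>k\<close> in \<open>ker T\<close> and \<open>l\<close> in \<open>ker T\<^sup>*\<close>
  with \<open>k \<bottom> l\<close> and \<open>T l \<bottom> k\<close>, and let \<open>s\<close> be an orthonormal basis of the complement of both.
  Let \<open>B\<close> shift \<open>s\<close> to \<open>l\<close>, \<open>l\<close> to \<open>k\<close> and \<open>k\<close> to \<open>0\<close>, and let \<open>A = T D\<close> where \<open>D\<close> shifts
  \<open>l\<close> to \<open>s\<close>, \<open>k\<close> to \<open>l\<close> and \<open>s\<close> to \<open>0\<close>. Then \<open>D B\<close> is the projection away from \<open>k\<close>, on
  which \<open>T\<close> vanishes, so \<open>A B = T\<close>. As \<open>ran T \<bottom> l\<close>, \<open>A\<close> maps everything into the span of \<open>k\<close> and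
  \<open>s\<close>, then into the closed span of \<open>T l\<close>, which is orthogonal to \<open>k\<close> and \<open>l\<close>, then to \<open>0\<close>.
\<close>

section \<open>Complex inner products and bounded operators\<close>

lemma cinner_zero_left [simp]: "cinner 0 y = 0"
  for y :: "'a::complex_hilbert_space"
  using cinner_add_left[of 0 0 y] by simp

lemma cinner_zero_right [simp]: "cinner x 0 = 0"
  for x :: "'a::complex_hilbert_space"
  using cinner_commute[of x 0] by simp

lemma cinner_eq_zero_commute: "cinner x y = 0 \<longleftrightarrow> cinner y x = 0"
  for x y :: "'a::complex_hilbert_space"
  using cinner_commute[of x y] cinner_commute[of y x] by auto

lemma cinner_self_eq_zero [simp]: "cinner x x = 0 \<longleftrightarrow> x = 0"
  for x :: "'a::complex_hilbert_space"
  by (simp add: norm_cinner)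

lemma cinner_scaleC_right: "cinner x (a *\<^sub>C y) = cnj a * cinner x y"
  for x y :: "'a::complex_hilbert_space"
  using cinner_commute[of x "a *\<^sub>C y"] cinner_commute[of x y] by (simp add: cinner_scaleC_left)

lemma cinner_add_right: "cinner x (y + z) = cinner x y + cinner x z"
  for x y z :: "'a::complex_hilbert_space"
  using cinner_commute[of x "y + z"] cinner_commute[of x y] cinner_commute[of x z]
  by (simp add: cinner_add_left)

lemma cinner_diff_left: "cinner (x - y) z = cinner x z - cinner y z"
  for x y z :: "'a::complex_hilbert_space"
  using cinner_add_left[of "x - y" y z] by (simp add: algebra_simps)

lemma cinner_diff_right: "cinner x (y - z) = cinner x y - cinner x z"
  for x y z :: "'a::complex_hilbert_space"
  using cinner_add_right[of x "y - z" z] by (simp add: algebra_simps)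

lemma cinner_sum_left: "cinner (\<Sum>i\<in>I. f i) y = (\<Sum>i\<in>I. cinner (f i) y)"
  for y :: "'a::complex_hilbert_space"
  by (induction I rule: infinite_finite_induct) (simp_all add: cinner_add_left)

lemma norm_power2_eq_cinner: "(norm x)\<^sup>2 = Re (cinner x x)"
  for x :: "'a::complex_hilbert_space"
  by (simp add: norm_cinner)

lemma norm_diff_power2:
  "(norm (x - y))\<^sup>2 = (norm x)\<^sup>2 - 2 * Re (cinner x y) + (norm y)\<^sup>2"
  for x y :: "'a::complex_hilbert_space"
proof -
  have "Re (cinner y x) = Re (cinner x y)"
    using cinner_commute[of x y] by simp
  then show ?thesis
    by (simp add: norm_power2_eq_cinner cinner_diff_left cinner_diff_right)
qed

lemma norm_add_power2_orthogonal:
  fixes x y :: "'a::complex_hilbert_space"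
  assumes "cinner x y = 0"
  shows "(norm (x + y))\<^sup>2 = (norm x)\<^sup>2 + (norm y)\<^sup>2"
  using assms cinner_eq_zero_commute[of x y]
  by (simp add: norm_power2_eq_cinner cinner_add_left cinner_add_right)

lemma Cauchy_Schwarz_cinner: "cmod (cinner x y) \<le> norm x * norm y"
  for x y :: "'a::complex_hilbert_space"
proof (cases "y = 0")
  case False
  define c where "c = cinner x y / complex_of_real ((norm y)\<^sup>2)"
  have "cinner x (c *\<^sub>C y) = complex_of_real ((cmod (cinner x y))\<^sup>2 / (norm y)\<^sup>2)"
    unfolding c_def cinner_scaleC_right by (simp add: complex_norm_square mult.commute del: of_real_power)
  moreover have "(norm (c *\<^sub>C y))\<^sup>2 = (cmod (cinner x y))\<^sup>2 / (norm y)\<^sup>2"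
    using False by (simp add: c_def norm_scaleC norm_divide norm_mult power2_eq_square)
  ultimately have "(norm (x - c *\<^sub>C y))\<^sup>2 = (norm x)\<^sup>2 - (cmod (cinner x y))\<^sup>2 / (norm y)\<^sup>2"
    unfolding norm_diff_power2 by simp
  then have "(cmod (cinner x y))\<^sup>2 / (norm y)\<^sup>2 \<le> (norm x)\<^sup>2"
    using zero_le_power2[of "norm (x - c *\<^sub>C y)"] by linarith
  then have "(cmod (cinner x y))\<^sup>2 \<le> (norm x * norm y)\<^sup>2"
    using False by (simp add: field_simps)
  then show ?thesis
    by (rule power2_le_imp_le) simp
qed simp

section \<open>Bounded complex-linear operators\<close>

lemma bounded_clinearI:
  assumes "\<And>x y. T (x + y) = T x + T y" and "\<And>a x. T (a *\<^sub>C x) = a *\<^sub>C T x"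
    and "\<And>x. norm (T x) \<le> K * norm x"
  shows "bounded_clinear T"
  unfolding bounded_clinear_def
  using assms by (auto simp: Vector_Spaces.linear_iff complex_vector.vector_space_axioms)

lemma bounded_clinear_add: "bounded_clinear T \<Longrightarrow> T (x + y) = T x + T y"
  by (simp add: bounded_clinear_def Vector_Spaces.linear_iff)

lemma bounded_clinear_scaleC: "bounded_clinear T \<Longrightarrow> T (a *\<^sub>C x) = a *\<^sub>C T x"
  by (simp add: bounded_clinear_def Vector_Spaces.linear_iff)

text \<open>Forgetting the complex structure makes the real theory of continuity and of series
  available for these operators.\<close>

lemma bounded_clinear_bounded_linear:
  assumes "bounded_clinear T"
  shows "bounded_linear T"
proof -
  obtain K where "norm (T x) \<le> K * norm x" for x
    using assms by (auto simp: bounded_clinear_def)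
  then show ?thesis
    by (intro bounded_linear_intro[where K = K])
      (simp_all add: bounded_clinear_add[OF assms] bounded_clinear_scaleC[OF assms]
        scaleR_scaleC mult.commute)
qed

lemma bounded_clinear_zero [simp]: "bounded_clinear T \<Longrightarrow> T 0 = 0"
  by (simp add: bounded_clinear_bounded_linear linear_simps)

lemma bounded_clinear_ident: "bounded_clinear (\<lambda>x. x)"
  by (rule bounded_clinearI[where K = 1]) simp_all

lemma bounded_clinear_plus:
  assumes "bounded_clinear S" and "bounded_clinear T"
  shows "bounded_clinear (\<lambda>x. S x + T x)"
proof -
  obtain K L where "norm (S x) \<le> K * norm x" "norm (T x) \<le> L * norm x" for x
    using assms by (auto simp: bounded_clinear_def)
  then have "norm (S x + T x) \<le> (K + L) * norm x" for x
    by (smt (verit) distrib_right norm_triangle_ineq)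
  then show ?thesis
    by (intro bounded_clinearI[where K = "K + L"])
      (simp_all add: assms bounded_clinear_add bounded_clinear_scaleC scaleC_add_right algebra_simps)
qed

lemma bounded_clinear_compose:
  assumes "bounded_clinear S" and "bounded_clinear T"
  shows "bounded_clinear (\<lambda>x. S (T x))"
proof -
  obtain K where "norm (S (T x)) \<le> norm x * K" for x
    using bounded_linear.bounded[OF bounded_linear_compose[OF
          bounded_clinear_bounded_linear[OF assms(1)] bounded_clinear_bounded_linear[OF assms(2)]]]
    by blast
  then show ?thesis
    by (intro bounded_clinearI[where K = K])
      (simp_all add: assms bounded_clinear_add bounded_clinear_scaleC mult.commute)
qed

lemma bounded_linear_scaleC_right: "bounded_linear (\<lambda>x::'a::complex_normed_vector. a *\<^sub>C x)"
  by (rule bounded_linear_intro[where K = "cmod a"])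
    (simp_all add: scaleC_add_right scaleR_scaleC scaleC_scaleC norm_scaleC mult.commute)

lemma bounded_linear_cinner_left: "bounded_linear (\<lambda>x. cinner x y)"
  for y :: "'a::complex_hilbert_space"
  by (rule bounded_linear_intro[where K = "norm y"])
    (simp_all add: cinner_add_left scaleR_scaleC cinner_scaleC_left Cauchy_Schwarz_cinner
      scaleC_complex_def)

lemma csubspace_orthogonal: "csubspace {x. cinner x y = 0}"
  for y :: "'a::complex_hilbert_space"
  by (simp add: complex_vector.subspace_def cinner_add_left cinner_scaleC_left)

lemma csubspace_kernel: "bounded_clinear T \<Longrightarrow> csubspace {x. T x = 0}"
  by (simp add: complex_vector.subspace_def bounded_clinear_add bounded_clinear_scaleC
      complex_vector.scale_zero_right)


section \<open>Infinite-dimensional subspaces\<close>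

text \<open>A maximal independent subset of \<open>V\<close> has at most as many elements as
  \<open>B\<close>, and it spans exactly \<open>V\<close>, as the definition of
  \<open>infinite_cdim\<close> demands.\<close>

lemma finite_cspan_subspace:
  assumes "csubspace V" and "V \<subseteq> cspan B" and "finite B"
  shows "\<not> infinite_cdim V"
proof -
  obtain C where C: "C \<subseteq> V" "complex_vector.independent C" "V \<subseteq> cspan C"
    by (rule complex_vector.maximal_independent_subset)
  then have "finite C"
    using complex_vector.independent_span_bound[OF assms(3), of C] assms(2) by blast
  moreover have "cspan C = V"
    using C assms(1) by (simp add: complex_vector.span_minimal subset_antisym)
  ultimately show ?thesis
    by (auto simp: infinite_cdim_def)
qed

lemma infinite_cdim_mono:
  assumes "csubspace V" and "infinite_cdim V" and "V \<subseteq> W"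
  shows "infinite_cdim W"
  using assms finite_cspan_subspace[of V] by (auto simp: infinite_cdim_def)

text \<open>One linear condition lowers the dimension by at most one: if \<open>B\<close> spans the
  intersection and \<open>v\<close> in \<open>V\<close> violates the condition, subtracting a
  multiple of \<open>v\<close> moves any vector of \<open>V\<close> into the intersection, so
  \<open>insert v B\<close> spans \<open>V\<close>.\<close>

lemma infinite_cdim_Int_orthogonal:
  fixes y :: "'a::complex_hilbert_space"
  assumes V: "csubspace V" and inf: "infinite_cdim V"
  shows "infinite_cdim (V \<inter> {x. cinner x y = 0})"
proof (rule ccontr)
  assume "\<not> ?thesis"
  then obtain B where B: "finite B" "cspan B = V \<inter> {x. cinner x y = 0}"
    by (auto simp: infinite_cdim_def)
  have "\<not> V \<subseteq> {x. cinner x y = 0}"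
    using B inf by (metis Int_absorb2 infinite_cdim_def)
  then obtain v where v: "v \<in> V" "cinner v y \<noteq> 0"
    by auto
  have "x \<in> cspan (insert v B)" if "x \<in> V" for x
  proof -
    have "x - (cinner x y / cinner v y) *\<^sub>C v \<in> cspan B"
      unfolding B(2) using that v V
      by (simp add: complex_vector.subspace_diff complex_vector.subspace_scale
          cinner_diff_left cinner_scaleC_left)
    then show ?thesis
      by (auto simp: complex_vector.span_insert)
  qed
  then have "\<not> infinite_cdim V"
    using finite_cspan_subspace[OF V, of "insert v B"] B(1) by auto
  with inf show False
    by simp
qed

text \<open>Finitely many orthogonality conditions, imposed one at a time, leave an
  infinite-dimensional subspace. This is what lets the inductive choice of \<open>k\<close> and
  \<open>l\<close> continue at every stage.\<close>

lemma infinite_cdim_unit_orthogonal: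
  fixes V :: "'a::complex_hilbert_space set"
  assumes "csubspace V" and "infinite_cdim V" and "finite F"
  obtains x where "x \<in> V" and "norm x = 1" and "\<And>y. y \<in> F \<Longrightarrow> cinner x y = 0"
proof -
  have "csubspace (V \<inter> {x. \<forall>y\<in>F. cinner x y = 0}) \<and> infinite_cdim (V \<inter> {x. \<forall>y\<in>F. cinner x y = 0})"
    using assms(3)
  proof induction
    case empty
    then show ?case
      using assms by simp
  next
    case (insert y F)
    have "V \<inter> {x. \<forall>z\<in>insert y F. cinner x z = 0}
        = (V \<inter> {x. \<forall>z\<in>F. cinner x z = 0}) \<inter> {x. cinner x y = 0}"
      by auto
    moreover have "csubspace ((V \<inter> {x. \<forall>z\<in>F. cinner x z = 0}) \<inter> {x. cinner x y = 0})"
      using insert.IH by (blast intro: complex_vector.subspace_inter csubspace_orthogonal)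
    ultimately show ?case
      using insert.IH infinite_cdim_Int_orthogonal[of "V \<inter> {x. \<forall>z\<in>F. cinner x z = 0}" y]
      by simp
  qed
  then have W: "csubspace (V \<inter> {x. \<forall>y\<in>F. cinner x y = 0})"
    and inf: "infinite_cdim (V \<inter> {x. \<forall>y\<in>F. cinner x y = 0})"
    by simp_all
  \<comment> \<open>The empty set spans the zero space, so an infinite-dimensional space has a
    nonzero vector, which is then normalised.\<close>
  have "cspan {} \<noteq> V \<inter> {x. \<forall>y\<in>F. cinner x y = 0}"
    using inf finite.emptyI unfolding infinite_cdim_def by metis
  then have "V \<inter> {x. \<forall>y\<in>F. cinner x y = 0} \<noteq> {0}"
    by simp
  then obtain z where z: "z \<in> V \<inter> {x. \<forall>y\<in>F. cinner x y = 0}" "z \<noteq> 0"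
    using complex_vector.subspace_0[OF W] by blast
  show thesis
  proof (rule that)
    show "complex_of_real (1 / norm z) *\<^sub>C z \<in> V"
      using z assms(1) by (simp add: complex_vector.subspace_scale)
    show "norm (complex_of_real (1 / norm z) *\<^sub>C z) = 1"
      using z(2) by (simp add: norm_scaleC norm_divide)
    show "cinner (complex_of_real (1 / norm z) *\<^sub>C z) y = 0" if "y \<in> F" for y
      using z(1) that by (simp add: cinner_scaleC_left)
  qed
qed

text \<open>Rank-nullity in spanning form: a finite spanning set \<open>B\<close> of the kernel,
  together with preimages \<open>D\<close> of a finite spanning set of
  \<open>W \<inter> range T\<close>, spans the preimage of \<open>W\<close>.\<close>

lemma finite_cdim_vimage:
  assumes T: "bounded_clinear T" and ker: "\<not> infinite_cdim {x. T x = 0}"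
    and W: "csubspace W" and fin: "\<not> infinite_cdim W"
  shows "\<not> infinite_cdim (T -` W)"
proof -
  interpret T: Vector_Spaces.linear scaleC scaleC T
    using T by (simp add: bounded_clinear_def)
  obtain B where B: "finite B" "cspan B = {x. T x = 0}"
    using ker by (auto simp: infinite_cdim_def)
  have "csubspace (W \<inter> range T)"
    by (intro complex_vector.subspace_inter W
        T.subspace_image[folded csubspace_def] complex_vector.subspace_UNIV)
  then have "\<not> infinite_cdim (W \<inter> range T)"
    using fin infinite_cdim_mono by blast
  then obtain C where C: "finite C" "cspan C = W \<inter> range T"
    by (auto simp: infinite_cdim_def)
  have "C \<subseteq> range T"
    using C(2) complex_vector.span_superset by blast
  then obtain D where D: "finite D" "C = T ` D"
    using C(1) by (meson finite_subset_image)
  have "x \<in> cspan (B \<union> D)" if "T x \<in> W" for x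
  proof -
    have "T x \<in> T ` cspan D"
      using that C(2) by (auto simp: T.span_image[folded cspan_def, symmetric] D(2)[symmetric])
    then obtain d where d: "d \<in> cspan D" "T x = T d"
      by auto
    then have "x - d \<in> cspan B"
      by (simp add: B(2) T.diff)
    then have "(x - d) + d \<in> cspan (B \<union> D)"
      using d(1) complex_vector.span_mono[of B "B \<union> D"] complex_vector.span_mono[of D "B \<union> D"]
      by (intro complex_vector.span_add) auto
    then show ?thesis
      by simp
  qed
  moreover have "csubspace (T -` W)"
    by (rule T.subspace_vimage[folded csubspace_def, OF W])
  ultimately show ?thesis
    using finite_cspan_subspace[of "T -` W" "B \<union> D"] B(1) D(1) by auto
qed

text \<open>The kernel of \<open>N ^^ Suc n\<close> is the preimage under \<open>N\<close> of the
  kernel of \<open>N ^^ n\<close>. A finite-dimensional kernel of \<open>N\<close> would thus make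
  all these kernels finite-dimensional, including the whole space at \<open>k\<close>.\<close>

lemma infinite_cdim_kernel_nilpotent:
  fixes N :: "'a::complex_normed_vector \<Rightarrow> 'a"
  assumes inf: "infinite_cdim (UNIV :: 'a set)" and N: "bounded_clinear N"
    and nil: "N ^^ k = (\<lambda>x. 0)"
  shows "infinite_cdim {x. N x = 0}"
proof (rule ccontr)
  assume ker: "\<not> ?thesis"
  have "csubspace {x. (N ^^ n) x = 0} \<and> \<not> infinite_cdim {x. (N ^^ n) x = 0}" for n
  proof (induction n)
    case 0
    have "cspan {} = {x::'a. x = 0}"
      by simp
    then show ?case
      by (auto simp: infinite_cdim_def complex_vector.subspace_def intro!: exI[of _ "{}"])
  next
    case (Suc n)
    have "{x. (N ^^ Suc n) x = 0} = N -` {x. (N ^^ n) x = 0}"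
      by (auto simp: funpow_swap1)
    moreover have "csubspace (N -` {x. (N ^^ n) x = 0})"
      using Suc by (auto simp: complex_vector.subspace_def bounded_clinear_add[OF N]
          bounded_clinear_scaleC[OF N] bounded_clinear_zero[OF N])
    ultimately show ?case
      using finite_cdim_vimage[OF N ker, of "{x. (N ^^ n) x = 0}"] Suc.IH by (metis (lifting))
  qed
  from this[of k] show False
    using inf by (simp add: nil)
qed


section \<open>Orthonormal sequences\<close>

text \<open>Zero vectors are admitted, so that bases of finite and infinite length are treated alike.\<close>

definition partial_orthonormal :: "(nat \<Rightarrow> 'a::complex_hilbert_space) \<Rightarrow> bool"
  where "partial_orthonormal e \<longleftrightarrow>
    (\<forall>m n. cinner (e m) (e n) = (if m = n \<and> e n \<noteq> 0 then 1 else 0))"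

lemma norm_sum_partial_orthonormal:
  assumes e: "partial_orthonormal e" and "finite I"
  shows "(norm (\<Sum>i\<in>I. c i *\<^sub>C e i))\<^sup>2 = (\<Sum>i\<in>I. if e i = 0 then 0 else (cmod (c i))\<^sup>2)"
  using assms(2)
proof (induction I)
  case (insert j I)
  have "cinner (c j *\<^sub>C e j) (\<Sum>i\<in>I. c i *\<^sub>C e i) = 0"
    using e insert.hyps
    by (subst cinner_eq_zero_commute)
      (auto simp: cinner_sum_left cinner_scaleC_left cinner_scaleC_right partial_orthonormal_def intro!: sum.neutral)
  moreover have "(norm (c j *\<^sub>C e j))\<^sup>2 = (if e j = 0 then 0 else (cmod (c j))\<^sup>2)"
    unfolding norm_power2_eq_cinner[of "c j *\<^sub>C e j"] cinner_scaleC_left cinner_scaleC_right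
    using e by (simp add: partial_orthonormal_def complex_mult_cnj cmod_power2)
      (simp add: power2_eq_square)
  ultimately show ?case
    using insert by (simp add: norm_add_power2_orthogonal)
qed simp

lemma norm_sum_partial_orthonormal_le:
  assumes e: "partial_orthonormal e" and "finite I"
  shows "(norm (\<Sum>i\<in>I. c i *\<^sub>C e i))\<^sup>2 \<le> (\<Sum>i\<in>I. (cmod (c i))\<^sup>2)"
  unfolding norm_sum_partial_orthonormal[OF assms] by (intro sum_mono) simp

text \<open>By Pythagoras a block of the vector series is controlled by the same block of the scalar
  series, so the partial sums are Cauchy and completeness applies.\<close>

lemma summable_partial_orthonormal:
  fixes e :: "nat \<Rightarrow> 'a::complex_hilbert_space"
  assumes e: "partial_orthonormal e" and c: "summable (\<lambda>n. (cmod (c n))\<^sup>2)"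
  shows "summable (\<lambda>n. c n *\<^sub>C e n)"
proof -
  have "Cauchy (\<lambda>n. \<Sum>i<n. c i *\<^sub>C e i)"
  proof (rule CauchyI')
    fix r :: real
    assume r: "0 < r"
    obtain M where M: "norm (\<Sum>i\<in>{m..<n}. (cmod (c i))\<^sup>2) < r\<^sup>2" if "m \<ge> M" for m n
      using c r unfolding summable_Cauchy by (meson zero_less_power)
    have "dist (\<Sum>i<m. c i *\<^sub>C e i) (\<Sum>i<n. c i *\<^sub>C e i) < r" if "m \<ge> M" "m < n" for m n
    proof -
      have "(\<Sum>i<n. c i *\<^sub>C e i) - (\<Sum>i<m. c i *\<^sub>C e i) = (\<Sum>i\<in>{m..<n}. c i *\<^sub>C e i)"
        using sum_diff_nat_ivl[of 0 m n "\<lambda>i. c i *\<^sub>C e i"] that by (simp add: lessThan_atLeast0)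
      moreover have "(norm (\<Sum>i\<in>{m..<n}. c i *\<^sub>C e i))\<^sup>2 < r\<^sup>2"
        using norm_sum_partial_orthonormal_le[OF e, of "{m..<n}" c] M[of m n] that by simp
      then have "norm (\<Sum>i\<in>{m..<n}. c i *\<^sub>C e i) < r"
        using r power2_less_imp_less by (meson less_imp_le)
      ultimately show ?thesis
        by (metis dist_norm norm_minus_commute)
    qed
    then show "\<exists>M. \<forall>m\<ge>M. \<forall>n>m. dist (\<Sum>i<m. c i *\<^sub>C e i) (\<Sum>i<n. c i *\<^sub>C e i) < r"
      by blast
  qed
  then show ?thesis
    by (simp add: summable_iff_convergent Cauchy_convergent)
qed

text \<open>With \<open>s\<close> the partial Fourier sum, expand the nonnegative square of
  \<open>norm (x - s)\<close>: the real part of \<open>cinner x s\<close> equals the sum of squares,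
  and the square of \<open>norm s\<close> does not exceed it.\<close>

lemma Bessel_inequality:
  fixes e :: "nat \<Rightarrow> 'a::complex_hilbert_space"
  assumes e: "partial_orthonormal e"
  shows "(\<Sum>i<n. (cmod (cinner x (e i)))\<^sup>2) \<le> (norm x)\<^sup>2"
proof -
  define s where "s = (\<Sum>i<n. cinner x (e i) *\<^sub>C e i)"
  have "cinner s x = (\<Sum>i<n. complex_of_real ((cmod (cinner x (e i)))\<^sup>2))"
    unfolding s_def cinner_sum_left cinner_scaleC_left
    by (intro sum.cong refl) (metis cinner_commute complex_norm_square)
  moreover have "Re (cinner x s) = Re (cinner s x)"
    using cinner_commute[of x s] by simp
  ultimately have "Re (cinner x s) = (\<Sum>i<n. (cmod (cinner x (e i)))\<^sup>2)"
    by simp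
  moreover have "(norm s)\<^sup>2 \<le> (\<Sum>i<n. (cmod (cinner x (e i)))\<^sup>2)"
    unfolding s_def by (rule norm_sum_partial_orthonormal_le[OF e]) simp
  ultimately show ?thesis
    using norm_diff_power2[of x s] zero_le_power2[of "norm (x - s)"] by linarith
qed

lemma summable_Bessel:
  assumes "partial_orthonormal e"
  shows "summable (\<lambda>n. (cmod (cinner x (e n)))\<^sup>2)"
  by (rule bounded_imp_summable[where B = "(norm x)\<^sup>2"])
    (use Bessel_inequality[OF assms, of x "Suc _"] in \<open>simp_all add: lessThan_Suc_atMost\<close>)

text \<open>For orthonormal sequences without zero entries this is the partial isometry that sends
  \<open>a n\<close> to \<open>b n\<close> and vanishes on the orthogonal complement of
  \<open>a\<close>. For \<open>a = b\<close> it is the orthogonal projection onto their closed span.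
  All shifts and projections below are of this form.\<close>

definition transfer_operator ::
    "(nat \<Rightarrow> 'a::complex_hilbert_space) \<Rightarrow> (nat \<Rightarrow> 'b::complex_hilbert_space) \<Rightarrow> 'a \<Rightarrow> 'b"
  where "transfer_operator a b x = (\<Sum>n. cinner x (a n) *\<^sub>C b n)"

lemma transfer_operator_sums:
  assumes "partial_orthonormal a" and "partial_orthonormal b"
  shows "(\<lambda>n. cinner x (a n) *\<^sub>C b n) sums transfer_operator a b x"
  unfolding transfer_operator_def
  by (intro summable_sums summable_partial_orthonormal summable_Bessel assms)

lemma bounded_clinear_transfer_operator:
  assumes a: "partial_orthonormal a" and b: "partial_orthonormal b"
  shows "bounded_clinear (transfer_operator a b)"
proof (rule bounded_clinearI[where K = 1])
  note sums = transfer_operator_sums[OF a b]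
  fix x y and c :: complex
  have "(\<lambda>n. cinner (x + y) (a n) *\<^sub>C b n) sums (transfer_operator a b x + transfer_operator a b y)"
    using sums_add[OF sums[of x] sums[of y]] by (simp add: cinner_add_left scaleC_add_left)
  then show "transfer_operator a b (x + y) = transfer_operator a b x + transfer_operator a b y"
    using sums sums_unique2 by blast
  have "(\<lambda>n. cinner (c *\<^sub>C x) (a n) *\<^sub>C b n) sums (c *\<^sub>C transfer_operator a b x)"
    using bounded_linear.sums[OF bounded_linear_scaleC_right sums[of x], of c]
    by (simp add: cinner_scaleC_left scaleC_scaleC)
  then show "transfer_operator a b (c *\<^sub>C x) = c *\<^sub>C transfer_operator a b x"
    using sums sums_unique2 by blast
  have "norm (\<Sum>i<n. cinner x (a i) *\<^sub>C b i) \<le> norm x" for n :: nat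
    using norm_sum_partial_orthonormal_le[OF b, of "{..<n}" "\<lambda>i. cinner x (a i)"]
      Bessel_inequality[OF a, of x n]
    by (intro power2_le_imp_le[OF _ norm_ge_zero]) (meson finite_lessThan order_trans)
  then show "norm (transfer_operator a b x) \<le> 1 * norm x"
    using LIMSEQ_le_const2[OF tendsto_norm[OF sums[of x, unfolded sums_def]]] by simp
qed

lemma transfer_operator_cinner_sums:
  assumes "partial_orthonormal a" and "partial_orthonormal b"
  shows "(\<lambda>n. cinner x (a n) * cinner (b n) y) sums cinner (transfer_operator a b x) y"
  using bounded_linear.sums[OF bounded_linear_cinner_left transfer_operator_sums[OF assms, of x], of y]
  by (simp add: cinner_scaleC_left)

lemma transfer_operator_orthogonal:
  assumes "partial_orthonormal a" and "partial_orthonormal b" and "\<And>n. cinner (b n) y = 0"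
  shows "cinner (transfer_operator a b x) y = 0"
  using transfer_operator_cinner_sums[OF assms(1,2), of x y] assms(3) by (simp add: sums_iff)

lemma transfer_operator_eq_zero:
  assumes "\<And>n. cinner x (a n) = 0"
  shows "transfer_operator a b x = 0"
  using assms by (simp add: transfer_operator_def)

lemma transfer_operator_coefficient:
  assumes "partial_orthonormal a" and b: "partial_orthonormal b" and "b n \<noteq> 0"
  shows "cinner (transfer_operator a b x) (b n) = cinner x (a n)"
proof -
  have "(\<lambda>m. cinner x (a m) * cinner (b m) (b n)) = (\<lambda>m. if m = n then cinner x (a m) else 0)"
    using assms(3) b by (auto simp: partial_orthonormal_def)
  then show ?thesis
    using transfer_operator_cinner_sums[OF assms(1,2), of x "b n"]
      sums_single[of n "\<lambda>m. cinner x (a m)"] sums_unique2 by metis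
qed

text \<open>The middle sequence must be free of zeros for the coefficients to survive; the outer
  ones may contain zeros. In the factorization only \<open>k\<close> and \<open>l\<close> occur in
  the middle, so zeros in \<open>s\<close> do no harm.\<close>

lemma transfer_operator_compose:
  assumes "partial_orthonormal a" and "partial_orthonormal b" and "\<And>n. b n \<noteq> 0"
  shows "transfer_operator b c (transfer_operator a b x) = transfer_operator a c x"
  using transfer_operator_coefficient[OF assms(1,2) assms(3), of x]
  by (simp add: transfer_operator_def[of b c] transfer_operator_def[of a c])

lemma transfer_operator_compose_orthogonal:
  assumes "partial_orthonormal a" and "partial_orthonormal b" and "\<And>m n. cinner (b m) (c n) = 0"
  shows "transfer_operator c d (transfer_operator a b x) = 0"
  by (intro transfer_operator_eq_zero transfer_operator_orthogonal assms)

lemma transfer_operator_self: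
  assumes "partial_orthonormal e"
  shows "transfer_operator e e (e n) = e n"
proof -
  have "(\<lambda>m. cinner (e n) (e m) *\<^sub>C e m) = (\<lambda>m. if m = n then e m else 0)"
    using assms by (auto simp: partial_orthonormal_def scaleC_one complex_vector.scale_zero_left)
  then show ?thesis
    using sums_single[of n e] by (simp add: transfer_operator_def sums_iff)
qed

lemma transfer_operator_on_cspan:
  assumes e: "partial_orthonormal e" and x: "x \<in> cspan (range e)"
  shows "transfer_operator e e x = x"
proof -
  note lin = bounded_clinear_transfer_operator[OF e e]
  have "csubspace {x. transfer_operator e e x = x}"
    by (simp add: complex_vector.subspace_def bounded_clinear_add[OF lin]
        bounded_clinear_scaleC[OF lin] bounded_clinear_zero[OF lin])
  then have "cspan (range e) \<subseteq> {x. transfer_operator e e x = x}"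
    using transfer_operator_self[OF e] by (intro complex_vector.span_minimal) auto
  with x show ?thesis
    by blast
qed

text \<open>Since \<open>sgn 0 = 0\<close>, a vector that depends linearly on its predecessors becomes \<open>0\<close>.\<close>

fun gram_schmidt :: "(nat \<Rightarrow> 'a::complex_hilbert_space) \<Rightarrow> nat \<Rightarrow> 'a"
  where "gram_schmidt d n =
    sgn (d n - (\<Sum>i<n. cinner (d n) (gram_schmidt d i) *\<^sub>C gram_schmidt d i))"

declare gram_schmidt.simps [simp del]

lemma sgn_eq_scaleC: "sgn x = complex_of_real (inverse (norm x)) *\<^sub>C x"
  for x :: "'a::complex_normed_vector"
  by (simp add: sgn_div_norm scaleR_scaleC)

lemma partial_orthonormal_gram_schmidt: "partial_orthonormal (gram_schmidt d)"
proof -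
  let ?e = "gram_schmidt d"
  have self: "cinner (?e n) (?e n) = (if ?e n \<noteq> 0 then 1 else 0)" for n
    by (subst (1 2 3) gram_schmidt.simps) (simp add: norm_cinner norm_sgn sgn_zero_iff)
  have less: "cinner (?e n) (?e m) = 0" if "m < n" for m n
    using that
  proof (induction n arbitrary: m rule: less_induct)
    case (less n)
    \<comment> \<open>If \<open>?e m = 0\<close>, both sides vanish at \<open>i = m\<close>, so
      degenerate steps need no separate case.\<close>
    have "cinner (d n) (?e i) * cinner (?e i) (?e m)
        = (if i = m then cinner (d n) (?e m) else 0)" if "i < n" for i
      using less that self[of m] cinner_eq_zero_commute[of "?e i" "?e m"]
      by (cases i m rule: linorder_cases) auto
    then have "(\<Sum>i<n. cinner (d n) (?e i) * cinner (?e i) (?e m)) = cinner (d n) (?e m)"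
      using less.prems by simp
    then show ?case
      by (subst (1) gram_schmidt.simps)
        (simp add: sgn_eq_scaleC cinner_scaleC_left cinner_diff_left cinner_sum_left)
  qed
  show ?thesis
    unfolding partial_orthonormal_def
    using self less cinner_eq_zero_commute by (metis linorder_neqE_nat)
qed

lemma gram_schmidt_in_cspan: "gram_schmidt d n \<in> cspan (range d)"
proof (induction n rule: less_induct)
  case (less n)
  then show ?case
    by (subst gram_schmidt.simps)
      (unfold sgn_eq_scaleC, intro complex_vector.span_scale complex_vector.span_diff
        complex_vector.span_sum, auto intro: complex_vector.span_base)
qed

text \<open>The recursion is solved for \<open>d n\<close>: the residual \<open>r\<close> equals
  \<open>norm r\<close> times its normalisation, also when \<open>r = 0\<close>. Hence
  orthonormalising a dense sequence keeps the span dense.\<close>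

lemma in_cspan_gram_schmidt: "d n \<in> cspan (range (gram_schmidt d))"
proof -
  define r where "r = d n - (\<Sum>i<n. cinner (d n) (gram_schmidt d i) *\<^sub>C gram_schmidt d i)"
  have "gram_schmidt d n = sgn r"
    unfolding r_def by (rule gram_schmidt.simps)
  then have "r = complex_of_real (norm r) *\<^sub>C gram_schmidt d n"
    by (cases "r = 0") (simp_all add: sgn_eq_scaleC scaleC_scaleC scaleC_one complex_vector.scale_zero_left
        flip: of_real_mult)
  then have "d n = complex_of_real (norm r) *\<^sub>C gram_schmidt d n
      + (\<Sum>i<n. cinner (d n) (gram_schmidt d i) *\<^sub>C gram_schmidt d i)"
    by (simp add: r_def)
  also have "\<dots> \<in> cspan (range (gram_schmidt d))"
    by (intro complex_vector.span_add complex_vector.span_scale complex_vector.span_sum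
        complex_vector.span_base rangeI)
  finally show ?thesis .
qed

section \<open>Orthonormal bases of separable spaces\<close>

lemma separable_dense_sequence:
  assumes "separable_space (euclidean :: 'a::topological_space topology)"
  obtains d :: "nat \<Rightarrow> 'a::topological_space" where "closure (range d) = UNIV"
proof -
  obtain C :: "'a set" where C: "countable C" "closure C = UNIV"
    using assms unfolding separable_space_def by auto
  then have "C \<noteq> {}"
    by auto
  then have "range (from_nat_into C) = C"
    using C(1) by (rule range_from_nat_into)
  with C(2) show thesis
    using that[of "from_nat_into C"] by simp
qed

lemma bounded_clinear_eq_on_dense:
  assumes "bounded_clinear S" and "bounded_clinear T" and "closure (range d) = UNIV"
    and "\<And>n. S (d n) = T (d n)"
  shows "S x = T x"
proof -
  have "closed {x. S x = T x}"
    using assms(1,2)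
    by (intro closed_Collect_eq linear_continuous_on bounded_clinear_bounded_linear)
  then have "closure (range d) \<subseteq> {x. S x = T x}"
    using assms(4) by (intro closure_minimal) auto
  with assms(3) show ?thesis
    by auto
qed

text \<open>The projection onto the orthonormalised dense sequence fixes each member of that
  sequence, hence everything by continuity. The basis serves to construct the adjoint.\<close>

lemma orthonormal_basis_exists:
  assumes "separable_space (euclidean :: 'a::complex_hilbert_space topology)"
  obtains e :: "nat \<Rightarrow> 'a::complex_hilbert_space" where "partial_orthonormal e" and "\<And>x. transfer_operator e e x = x"
proof -
  obtain d :: "nat \<Rightarrow> 'a" where d: "closure (range d) = UNIV"
    using separable_dense_sequence[OF assms] .
  note e = partial_orthonormal_gram_schmidt[of d]
  have "transfer_operator (gram_schmidt d) (gram_schmidt d) x = x" for x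
    by (rule bounded_clinear_eq_on_dense[OF bounded_clinear_transfer_operator[OF e e]
          bounded_clinear_ident d])
      (rule transfer_operator_on_cspan[OF e in_cspan_gram_schmidt])
  with e that show thesis
    by blast
qed

text \<open>A dense sequence is projected onto the complement of \<open>k\<close> and
  \<open>l\<close> and then orthonormalised. The complement may be finite-dimensional or even
  trivial, so \<open>s\<close> may contain zeros.\<close>

lemma orthonormal_basis_extension:
  fixes k l :: "nat \<Rightarrow> 'a::complex_hilbert_space"
  assumes sep: "separable_space (euclidean :: 'a topology)"
    and k: "partial_orthonormal k" and l: "partial_orthonormal l"
    and kl: "\<And>m n. cinner (k m) (l n) = 0"
    and k0: "\<And>n. k n \<noteq> 0" and l0: "\<And>n. l n \<noteq> 0"
  obtains s where "partial_orthonormal s"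
    and "\<And>m n. cinner (s m) (k n) = 0" and "\<And>m n. cinner (s m) (l n) = 0"
    and "\<And>x. transfer_operator k k x + transfer_operator l l x + transfer_operator s s x = x"
proof -
  obtain d :: "nat \<Rightarrow> 'a" where d: "closure (range d) = UNIV"
    using separable_dense_sequence[OF sep] .
  let ?P = "\<lambda>x. transfer_operator k k x + transfer_operator l l x"
  define r where "r n = d n - ?P (d n)" for n
  define s where "s = gram_schmidt r"
  have s: "partial_orthonormal s"
    unfolding s_def by (rule partial_orthonormal_gram_schmidt)
  have lk: "cinner (l m) (k n) = 0" for m n
    using kl cinner_eq_zero_commute by blast
  have "cinner (r m) (k n) = 0" "cinner (r m) (l n) = 0" for m n
    by (simp_all add: r_def cinner_diff_left cinner_add_left transfer_operator_coefficient k l k0 l0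
        transfer_operator_orthogonal kl lk)
  then have "cspan (range r) \<subseteq> {x. cinner x (k n) = 0}" "cspan (range r) \<subseteq> {x. cinner x (l n) = 0}" for n
    by (intro complex_vector.span_minimal csubspace_orthogonal; blast)+
  then have sk: "cinner (s m) (k n) = 0" and sl: "cinner (s m) (l n) = 0" for m n
    using gram_schmidt_in_cspan[of r m] unfolding s_def by blast+
  note ops = bounded_clinear_transfer_operator[OF k k] bounded_clinear_transfer_operator[OF l l]
    bounded_clinear_transfer_operator[OF s s]
  have "?P x + transfer_operator s s x = x" for x
  proof (rule bounded_clinear_eq_on_dense[OF _ bounded_clinear_ident d])
    show "bounded_clinear (\<lambda>x. ?P x + transfer_operator s s x)"
      by (intro bounded_clinear_plus ops)
    fix n
    \<comment> \<open>The part of \<open>d n\<close> along \<open>k\<close> and \<open>l\<close> is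
      invisible to \<open>s\<close>, and the remainder \<open>r n\<close> lies in the span of
      \<open>s\<close>.\<close>
    have "transfer_operator s s (?P (d n)) = 0"
      using sk sl cinner_eq_zero_commute[of "s _"]
      by (simp add: bounded_clinear_add[OF ops(3)] transfer_operator_compose_orthogonal k l)
    moreover have "transfer_operator s s (r n) = r n"
      using transfer_operator_on_cspan[OF s] in_cspan_gram_schmidt[of r n] by (simp add: s_def)
    ultimately have "transfer_operator s s (d n) = r n"
      using bounded_clinear_add[OF ops(3), of "r n" "?P (d n)"] by (simp add: r_def)
    then show "?P (d n) + transfer_operator s s (d n) = d n"
      by (simp add: r_def)
  qed
  then show thesis
    using that[OF s sk sl] by blast
qed


section \<open>The adjoint\<close>

text \<open>Existence of the adjoint is shown without Riesz representation: the vector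
  \<open>S y\<close> is built from its prescribed coefficients along a basis, and uniqueness
  identifies \<open>S\<close> with \<open>cadjoint T\<close>.\<close>

lemma cinner_cadjoint:
  fixes T :: "'a::complex_hilbert_space \<Rightarrow> 'b::complex_hilbert_space"
  assumes sep: "separable_space (euclidean :: 'a topology)" and T: "bounded_clinear T"
  shows "cinner (T x) y = cinner x (cadjoint T y)"
proof -
  obtain e :: "nat \<Rightarrow> 'a" where e: "partial_orthonormal e" and basis: "\<And>x. transfer_operator e e x = x"
    using orthonormal_basis_exists[OF sep] by blast
  obtain K where K: "K \<ge> 0" "\<And>x. norm (T x) \<le> norm x * K"
    using bounded_linear.nonneg_bounded[OF bounded_clinear_bounded_linear[OF T]] by blast
  define S where "S y = (\<Sum>n. cinner y (T (e n)) *\<^sub>C e n)" for y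
  have S: "(\<lambda>n. cinner y (T (e n)) *\<^sub>C e n) sums S y" for y
  proof -
    \<comment> \<open>For a partial sum \<open>z\<close> of \<open>S y\<close>,
      \<open>cinner (T z) y\<close> is the square of \<open>norm z\<close>; Cauchy-Schwarz and the
      bound \<open>K\<close> then give \<open>norm z \<le> norm y * K\<close>.\<close>
    have "(\<Sum>i<n. (cmod (cinner y (T (e i))))\<^sup>2) \<le> (norm y * K)\<^sup>2" for n
    proof -
      define z where "z = (\<Sum>i<n. cinner y (T (e i)) *\<^sub>C e i)"
      \<comment> \<open>Equality holds despite zeros in \<open>e\<close>, because
        \<open>e i = 0\<close> forces \<open>T (e i) = 0\<close>.\<close>
      have z: "(norm z)\<^sup>2 = (\<Sum>i<n. (cmod (cinner y (T (e i))))\<^sup>2)"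
        unfolding z_def using T
        by (subst norm_sum_partial_orthonormal[OF e]) (auto intro!: sum.cong)
      have "T z = (\<Sum>i<n. cinner y (T (e i)) *\<^sub>C T (e i))"
        unfolding z_def
        by (simp add: linear_sum[OF bounded_linear.linear[OF bounded_clinear_bounded_linear[OF T]]]
            bounded_clinear_scaleC[OF T])
      then have "cinner (T z) y = (\<Sum>i<n. complex_of_real ((cmod (cinner y (T (e i))))\<^sup>2))"
        unfolding \<open>T z = _\<close> cinner_sum_left cinner_scaleC_left
        by (intro sum.cong refl) (metis cinner_commute complex_norm_square)
      then have "cinner (T z) y = complex_of_real ((norm z)\<^sup>2)"
        by (simp add: z)
      then have "(norm z)\<^sup>2 \<le> norm (T z) * norm y"
        using Cauchy_Schwarz_cinner[of "T z" y] by (simp add: norm_power)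
      also have "\<dots> \<le> (norm z * K) * norm y"
        by (intro mult_right_mono K) simp
      finally have "norm z \<le> norm y * K"
        by (cases "z = 0") (auto simp: power2_eq_square K(1) mult_ac)
      then show ?thesis
        unfolding z[symmetric] by (intro power_mono) simp_all
    qed
    then have "summable (\<lambda>n. (cmod (cinner y (T (e n))))\<^sup>2)"
      by (intro bounded_imp_summable[where B = "(norm y * K)\<^sup>2"] zero_le_power2)
        (simp only: lessThan_Suc_atMost[symmetric])
    then show ?thesis
      unfolding S_def by (intro summable_sums summable_partial_orthonormal e)
  qed
  have "cinner (T x) y = cinner x (S y)" for x y
  proof -
    have "(\<lambda>n. cinner x (e n) *\<^sub>C e n) sums x"
      using transfer_operator_sums[OF e e, of x] by (simp add: basis)
    then have "(\<lambda>n. cinner (T (cinner x (e n) *\<^sub>C e n)) y) sums cinner (T x) y"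
      by (intro bounded_linear.sums[OF bounded_linear_compose[OF bounded_linear_cinner_left
              bounded_clinear_bounded_linear[OF T]]])
    then have "(\<lambda>n. cinner x (e n) * cinner (T (e n)) y) sums cinner (T x) y"
      by (simp add: bounded_clinear_scaleC[OF T] cinner_scaleC_left)
    \<comment> \<open>The series for \<open>S y\<close> is paired in the first argument, where
      continuity is known, and conjugation carries it to the second.\<close>
    moreover have "(\<lambda>n. cnj (cinner (cinner y (T (e n)) *\<^sub>C e n) x)) sums cnj (cinner (S y) x)"
      by (intro bounded_linear.sums[OF bounded_linear_cnj]
          bounded_linear.sums[OF bounded_linear_cinner_left] S)
    then have "(\<lambda>n. cinner x (e n) * cinner (T (e n)) y) sums cinner x (S y)"
      using cinner_commute[of x] cinner_commute[of _ y]
      by (simp add: cinner_scaleC_left mult.commute)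
    ultimately show ?thesis
      by (rule sums_unique2)
  qed
  then show ?thesis
    using cadjoint_unique[of T S] by simp
qed

text \<open>The kernel of the adjoint is the orthogonal complement of the range, so kernels of
  adjoints can be compared through ranges.\<close>

lemma cadjoint_eq_zero_iff:
  fixes T :: "'a::complex_hilbert_space \<Rightarrow> 'b::complex_hilbert_space"
  assumes "separable_space (euclidean :: 'a topology)" and "bounded_clinear T"
  shows "cadjoint T y = 0 \<longleftrightarrow> (\<forall>x. cinner (T x) y = 0)"
  using cinner_cadjoint[OF assms] by (metis cinner_self_eq_zero cinner_zero_right)

lemma cinner_left_cancel: "(\<And>x. cinner x y = cinner x z) \<Longrightarrow> y = z"
  for y z :: "'a::complex_hilbert_space"
  using cinner_self_eq_zero[of "y - z"] by (simp add: cinner_diff_right)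

text \<open>Linearity follows by testing against every vector. For the bound, the square of
  \<open>norm ?z\<close> is \<open>cinner (T ?z) y\<close>, to which Cauchy-Schwarz applies; one
  factor \<open>norm ?z\<close> then cancels.\<close>

lemma bounded_clinear_cadjoint:
  fixes T :: "'a::complex_hilbert_space \<Rightarrow> 'b::complex_hilbert_space"
  assumes sep: "separable_space (euclidean :: 'a topology)" and T: "bounded_clinear T"
  shows "bounded_clinear (cadjoint T)"
proof -
  note adj = cinner_cadjoint[OF sep T, symmetric]
  obtain K where K: "K \<ge> 0" "\<And>x. norm (T x) \<le> norm x * K"
    using bounded_linear.nonneg_bounded[OF bounded_clinear_bounded_linear[OF T]] by blast
  show ?thesis
  proof (rule bounded_clinearI[where K = K])
    fix y z c
    show "cadjoint T (y + z) = cadjoint T y + cadjoint T z"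
      by (rule cinner_left_cancel) (simp add: adj cinner_add_right)
    show "cadjoint T (c *\<^sub>C y) = c *\<^sub>C cadjoint T y"
      by (rule cinner_left_cancel) (simp add: adj cinner_scaleC_right)
    let ?z = "cadjoint T y"
    have "(norm ?z)\<^sup>2 = cmod (cinner (T ?z) y)"
      by (simp add: cinner_cadjoint[OF sep T] norm_cinner norm_power)
    also have "\<dots> \<le> norm (T ?z) * norm y"
      by (rule Cauchy_Schwarz_cinner)
    also have "\<dots> \<le> (norm ?z * K) * norm y"
      by (intro mult_right_mono K) simp
    finally show "norm ?z \<le> K * norm y"
      by (cases "?z = 0") (auto simp: power2_eq_square K(1) mult_ac)
  qed
qed

lemma cadjoint_funpow:
  fixes T :: "'a::complex_hilbert_space \<Rightarrow> 'a"
  assumes "separable_space (euclidean :: 'a topology)" and "bounded_clinear T"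
  shows "cinner ((T ^^ n) x) y = cinner x ((cadjoint T ^^ n) y)"
  by (induction n arbitrary: x) (simp_all add: cinner_cadjoint[OF assms] funpow_swap1)


section \<open>Products of two nilpotent operators\<close>

lemma infinite_cdim_kernels_of_nilpotent_product:
  fixes A B :: "'a::complex_hilbert_space \<Rightarrow> 'a"
  assumes sep: "separable_space (euclidean :: 'a topology)"
    and inf: "infinite_cdim (UNIV :: 'a set)"
    and A: "nilpotent_operator A" and B: "nilpotent_operator B"
  shows "infinite_cdim {x. (A \<circ> B) x = 0}" and "infinite_cdim {x. cadjoint (A \<circ> B) x = 0}"
proof -
  obtain m n where lin: "bounded_clinear A" "bounded_clinear B"
    and nil: "A ^^ m = (\<lambda>x. 0)" "B ^^ n = (\<lambda>x. 0)"
    using A B by (auto simp: nilpotent_operator_def)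
  have "infinite_cdim {x. B x = 0}"
    using infinite_cdim_kernel_nilpotent[OF inf lin(2) nil(2)] .
  then show "infinite_cdim {x. (A \<circ> B) x = 0}"
    using lin by (elim infinite_cdim_mono[OF csubspace_kernel[OF lin(2)]]) auto
  note adj = bounded_clinear_cadjoint[OF sep lin(1)]
  have "cadjoint A ^^ m = (\<lambda>x. 0)"
    by (rule ext, rule cinner_left_cancel) (simp add: cadjoint_funpow[OF sep lin(1), symmetric] nil(1))
  then have "infinite_cdim {x. cadjoint A x = 0}"
    by (rule infinite_cdim_kernel_nilpotent[OF inf adj])
  moreover have "bounded_clinear (A \<circ> B)"
    unfolding comp_def by (rule bounded_clinear_compose[OF lin])
  \<comment> \<open>The range of \<open>A \<circ> B\<close> lies in that of \<open>A\<close>, so a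
    vector orthogonal to the latter is orthogonal to the former.\<close>
  ultimately show "infinite_cdim {x. cadjoint (A \<circ> B) x = 0}"
    by (elim infinite_cdim_mono[OF csubspace_kernel[OF adj]])
      (auto simp: cadjoint_eq_zero_iff[OF sep] lin)
qed

text \<open>\<open>S\<close> stands for the adjoint, so the last conclusion says that
  \<open>T (l m)\<close> is orthogonal to \<open>k n\<close>. Whichever of the two vectors is chosen
  later meets this as one more linear condition: \<open>k n\<close> avoids the earlier
  \<open>T (l m)\<close>, and \<open>l m\<close> avoids \<open>S (k n)\<close> for the
  \<open>k n\<close> already chosen.\<close>

lemma orthonormal_sequences_exist:
  fixes T :: "'a::complex_hilbert_space \<Rightarrow> 'a"
  assumes T: "\<And>x y. cinner (T x) y = cinner x (S y)"
    and V: "csubspace V" "infinite_cdim V" and W: "csubspace W" "infinite_cdim W"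
  obtains k l :: "nat \<Rightarrow> 'a" where "partial_orthonormal k" and "partial_orthonormal l"
    and "\<And>n. k n \<in> V" and "\<And>n. l n \<in> W" and "\<And>n. k n \<noteq> 0" and "\<And>n. l n \<noteq> 0"
    and "\<And>m n. cinner (k m) (l n) = 0" and "\<And>m n. cinner (l m) (S (k n)) = 0"
proof -
  define F where "F f n = (\<Union>i<n::nat. {fst (f i), snd (f i), T (snd (f i)), S (fst (f i))})"
    for f :: "nat \<Rightarrow> 'a \<times> 'a"  and n
  \<comment> \<open>Within one stage the vector of \<open>V\<close> comes first; the vector of
    \<open>W\<close> must also be orthogonal to it and to its image under \<open>S\<close>.\<close>
  define P where "P f n p \<longleftrightarrow> fst p \<in> V \<and> snd p \<in> W \<and> norm (fst p) = 1 \<and> norm (snd p) = 1 \<and>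
      (\<forall>y\<in>F f n. cinner (fst p) y = 0) \<and>
      (\<forall>y\<in>F f n \<union> {fst p, S (fst p)}. cinner (snd p) y = 0)" for f n p
  have "\<exists>f. \<forall>n. P f n (f n)"
  proof (rule dependent_wf_choice[of less_than])
    show "wf less_than"
      by simp
    show "P f n p = P g n p" if "\<And>z. (z, n) \<in> less_than \<Longrightarrow> f z = g z" for f g n p
    proof -
      have "F f n = F g n"
        using that by (auto simp: F_def)
      then show ?thesis
        by (simp add: P_def)
    qed
    show "\<exists>p. P f n p" for n f
    proof -
      have fin: "finite (F f n)"
        by (simp add: F_def)
      obtain x where x: "x \<in> V" "norm x = 1" "\<And>y. y \<in> F f n \<Longrightarrow> cinner x y = 0"
        using infinite_cdim_unit_orthogonal[OF V fin] by blast
      have fin': "finite (F f n \<union> {x, S x})"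
        using fin by simp
      obtain z where z: "z \<in> W" "norm z = 1" "\<And>y. y \<in> F f n \<union> {x, S x} \<Longrightarrow> cinner z y = 0"
        using infinite_cdim_unit_orthogonal[OF W fin'] by blast
      show ?thesis
        using x z by (intro exI[of _ "(x, z)"]) (simp add: P_def)
    qed
  qed
  then obtain f where f: "\<And>n. P f n (f n)"
    by blast
  define k l where "k n = fst (f n)" and "l n = snd (f n)" for n
  have unit: "k n \<in> V" "l n \<in> W" "norm (k n) = 1" "norm (l n) = 1" for n
    using f[of n] by (simp_all add: P_def k_def l_def)
  then have nz: "k n \<noteq> 0" "l n \<noteq> 0" for n
    by (metis norm_zero zero_neq_one)+
  have less: "cinner (k n) (k m) = 0" "cinner (k n) (l m) = 0" "cinner (k n) (T (l m)) = 0"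
    "cinner (l n) (k m) = 0" "cinner (l n) (l m) = 0" "cinner (l n) (S (k m)) = 0" if "m < n" for m n
    using f[of n] that by (auto simp: P_def F_def k_def l_def)
  have eq: "cinner (l n) (k n) = 0" "cinner (l n) (S (k n)) = 0" for n
    using f[of n] by (auto simp: P_def k_def l_def)
  have kl: "cinner (k m) (l n) = 0" for m n
    using less(2,4) eq(1) cinner_eq_zero_commute by (metis linorder_neqE_nat)
  \<comment> \<open>For \<open>m < n\<close> the adjoint relation turns this into orthogonality of
    \<open>k n\<close> to \<open>T (l m)\<close>; otherwise it was imposed on \<open>l m\<close>
    directly.\<close>
  have lSk: "cinner (l m) (S (k n)) = 0" for m n
    using less(3,6) eq(2) cinner_eq_zero_commute T by (metis linorder_neqE_nat)
  have "cinner (k m) (k n) = 0" "cinner (l m) (l n) = 0" if "m \<noteq> n" for m n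
    using less(1,5) cinner_eq_zero_commute that by (metis linorder_neqE_nat)+
  then have "partial_orthonormal k" "partial_orthonormal l"
    using nz unit(3,4) by (simp_all add: partial_orthonormal_def norm_cinner)
  then show thesis
    using that[of k l, OF _ _ unit(1,2) nz kl lSk] by simp
qed

lemma nilpotent_operatorI:
  assumes "bounded_clinear N" and "\<And>x. N (N (N x)) = 0"
  shows "nilpotent_operator N" and "nilpotency_index N \<le> 3"
proof -
  have "N ^^ 3 = (\<lambda>x. 0)"
    using assms(2) by (simp add: numeral_3_eq_3 fun_eq_iff)
  then show "nilpotent_operator N" "nilpotency_index N \<le> 3"
    using assms(1) unfolding nilpotent_operator_def nilpotency_index_def
    by (auto intro!: exI[of _ 3] Least_le)
qed

lemma nilpotent_factorization:
  fixes T :: "'a::complex_hilbert_space \<Rightarrow> 'a"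
  assumes sep: "separable_space (euclidean :: 'a topology)" and T: "bounded_clinear T"
    and ker: "infinite_cdim {x. T x = 0}" and coker: "infinite_cdim {x. cadjoint T x = 0}"
  obtains A B where "nilpotent_operator A" and "nilpotency_index A \<le> 3"
    and "nilpotent_operator B" and "nilpotency_index B \<le> 3" and "T = A \<circ> B"
proof -
  note adj = cinner_cadjoint[OF sep T]
  obtain k l where k: "partial_orthonormal k" and l: "partial_orthonormal l"
    and Tk: "T (k n) = 0" and Tl: "cadjoint T (l n) = 0" and nz: "k n \<noteq> 0" "l n \<noteq> 0"
    and kl: "cinner (k m) (l n) = 0" and lTk: "cinner (l m) (cadjoint T (k n)) = 0" for m n
    using orthonormal_sequences_exist[OF adj csubspace_kernel[OF T] ker
        csubspace_kernel[OF bounded_clinear_cadjoint[OF sep T]] coker] by auto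
  obtain s where s: "partial_orthonormal s"
    and sk: "cinner (s m) (k n) = 0" and sl: "cinner (s m) (l n) = 0"
    and basis: "transfer_operator k k x + transfer_operator l l x + transfer_operator s s x = x"
      for m n x
    using orthonormal_basis_extension[OF sep k l kl nz] by blast
  note perp = kl sk sl kl[THEN cinner_eq_zero_commute[THEN iffD1]]
    sk[THEN cinner_eq_zero_commute[THEN iffD1]] sl[THEN cinner_eq_zero_commute[THEN iffD1]]
  let ?U = transfer_operator
  define B where "B x = ?U s l x + ?U l k x" for x
  define D where "D x = ?U l s x + ?U k l x" for x
  define A where "A x = T (D x)" for x
  have lin: "bounded_clinear (?U a b)" if "a \<in> {k, l, s}" "b \<in> {k, l, s}" for a b
    using that k l s bounded_clinear_transfer_operator by blast
  note add = bounded_clinear_add[OF lin] bounded_clinear_zero[OF lin] bounded_clinear_add[OF T]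
  note comp = transfer_operator_compose transfer_operator_compose_orthogonal k l s nz perp
  have linB: "bounded_clinear B"
    unfolding B_def[abs_def] by (intro bounded_clinear_plus lin) simp_all
  have linA: "bounded_clinear A"
    unfolding A_def[abs_def] D_def[abs_def]
    by (intro bounded_clinear_compose[OF T] bounded_clinear_plus lin) simp_all
  \<comment> \<open>Only the path from \<open>s\<close> through \<open>l\<close> to \<open>k\<close>
    survives two applications; a third vanishes because \<open>k\<close> is orthogonal to
    \<open>s\<close> and \<open>l\<close>.\<close>
  have "B (B x) = ?U s k x" for x
    by (simp add: B_def add comp)
  then have B3: "B (B (B x)) = 0" for x
    by (simp add: B_def comp)
  \<comment> \<open>The range of \<open>T\<close> is orthogonal to \<open>l\<close>, which lies in
    the kernel of the adjoint, so the summand of \<open>D\<close> that reads off \<open>l\<close>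
    disappears.\<close>
  have DT: "D (T x) = ?U k l (T x)" for x
    unfolding D_def by (simp add: transfer_operator_eq_zero adj Tl)
  \<comment> \<open>The inner vector lies in the closed span of \<open>l\<close>, which
    \<open>T\<close> maps into the orthogonal complement of \<open>k\<close>. By \<open>DT\<close>
    this expression occurs inside the cube of \<open>A\<close>.\<close>
  have "?U k l (T (?U k l x)) = 0" for x
    by (intro transfer_operator_eq_zero) (simp add: adj transfer_operator_orthogonal k l lTk)
  then have A3: "A (A (A x)) = 0" for x
    by (simp add: A_def DT T)
  have "T x = A (B x)" for x
  proof -
    \<comment> \<open>\<open>T\<close> kills every term of the series, hence its sum by
      continuity.\<close>
    have "T (?U k k x) = 0"
      using bounded_linear.sums[OF bounded_clinear_bounded_linear[OF T]
          transfer_operator_sums[OF k k, of x]]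
      by (simp add: bounded_clinear_scaleC[OF T] Tk sums_iff complex_vector.scale_zero_right)
    then have "T x = T (?U l l x + ?U s s x)"
      using basis[of x] bounded_clinear_add[OF T] by (metis add.assoc add.left_neutral)
    moreover have "D (B x) = ?U l l x + ?U s s x"
      by (simp add: D_def B_def add comp add.commute)
    ultimately show ?thesis
      by (simp add: A_def)
  qed
  then have "T = A \<circ> B"
    by auto
  then show thesis
    using that nilpotent_operatorI[OF linA A3] nilpotent_operatorI[OF linB B3] by blast
qed

theorem theorem4p1:
  fixes T :: "'a::complex_hilbert_space \<Rightarrow> 'a"
  assumes separable: "separable_space (euclidean :: 'a topology)"
    and infinite_dimensional: "infinite_cdim (UNIV :: 'a set)"
    and bounded: "bounded_clinear T"
  shows "((\<exists>A B. nilpotent_operator A \<and> nilpotent_operator B \<and> T = A \<circ> B) \<longleftrightarrow>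
            infinite_cdim {x. T x = 0} \<and> infinite_cdim {x. cadjoint T x = 0}) \<and>
         (infinite_cdim {x. T x = 0} \<and> infinite_cdim {x. cadjoint T x = 0} \<longrightarrow>
            (\<exists>A B. nilpotent_operator A \<and> nilpotency_index A \<le> 3 \<and>
                   nilpotent_operator B \<and> nilpotency_index B \<le> 3 \<and> T = A \<circ> B))"
  using infinite_cdim_kernels_of_nilpotent_product[OF separable infinite_dimensional]
    nilpotent_factorization[OF separable bounded] by metis

end
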